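(* (Multiplication by $q^{n_1}r^{n_2}s^{n_3}t^{n_4}$.) Let $m,n,o,p>0$ and let $f:[0,\infty)^4\to\mathbb{C}$ be a function whose quadruple Shehu transform $\mathbb{H}^4_{qrst}[f(q,r,s,t)]=F[(h,j,k,l),(m,n,o,p)]$ exists for all $h>h_0$, $j>j_0$, $k>k_0$, $l>l_0$, where $h_0,j_0,k_0,l_0\ge 0$. Then for all integers $n_1,n_2,n_3,n_4\ge 0$ and all $h>h_0$, $j>j_0$, $k>k_0$, $l>l_0$, $$\mathbb{H}^4_{qrst}\left[q^{n_1}r^{n_2}s^{n_3}t^{n_4}f(q,r,s,t)\right]=(-1)^{n_1+n_2+n_3+n_4}\,m^{n_1}n^{n_2}o^{n_3}p^{n_4}\,\frac{\partial^{\,n_1+n_2+n_3+n_4}}{\partial h^{n_1}\,\partial j^{n_2}\,\partial k^{n_3}\,\partial l^{n_4}}F[(h,j,k,l),(m,n,o,p)].$$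
   Context: Quadruple Shehu transform: for a real- or complex-valued function $f(q,r,s,t)$ of $q,r,s,t\ge 0$ and parameters (Shehu variables) $h,j,k,l,m,n,o,p>0$, $$\mathbb{H}^4_{qrst}[f(q,r,s,t)]=F[(h,j,k,l),(m,n,o,p)]=\int_0^\infty\int_0^\infty\int_0^\infty\int_0^\infty e^{-\left(\frac{hq}{m}+\frac{jr}{n}+\frac{ks}{o}+\frac{lt}{p}\right)}f(q,r,s,t)\,dq\,dr\,ds\,dt,$$ provided the integral exists (as a Lebesgue integral over $(0,\infty)^4$). Here $n$ (without subscript) is a Shehu variable and $n_1,\dots,n_4$ are exponents. *)

theory Defs
  imports "HOL-Analysis.Analysis"
begin

type_synonym real4 = "real \<times> real \<times> real \<times> real"

definition quadrant4 :: "real4 set" where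
  "quadrant4 = {0<..} \<times> {0<..} \<times> {0<..} \<times> {0<..}"

text \<open>The name \<open>o\<close> is reserved syntax (composition), hence \<open>o'\<close> for the third
  denominator variable.\<close>

fun shehu4_integrand ::
  "(real \<Rightarrow> real \<Rightarrow> real \<Rightarrow> real \<Rightarrow> complex) \<Rightarrow> real4 \<Rightarrow> real4 \<Rightarrow> real4 \<Rightarrow> complex" where
  "shehu4_integrand f (h, j, k, l) (m, n, o', p) (q, r, s, t) =
     complex_of_real (exp (- (h * q / m + j * r / n + k * s / o' + l * t / p))) * f q r s t"

text \<open>The integral is the Lebesgue integral for the completed measure, so \<open>f\<close> need only be
  Lebesgue measurable on the open quadrant; its values elsewhere are irrelevant.\<close>

definition shehu4_exists ::
  "(real \<Rightarrow> real \<Rightarrow> real \<Rightarrow> real \<Rightarrow> complex) \<Rightarrow> real4 \<Rightarrow> real4 \<Rightarrow> bool" where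
  "shehu4_exists f x y \<longleftrightarrow> set_integrable lebesgue quadrant4 (shehu4_integrand f x y)"

definition shehu4 ::
  "(real \<Rightarrow> real \<Rightarrow> real \<Rightarrow> real \<Rightarrow> complex) \<Rightarrow> real4 \<Rightarrow> real4 \<Rightarrow> complex" where
  "shehu4 f x y = set_lebesgue_integral lebesgue quadrant4 (shehu4_integrand f x y)"

text \<open>For a unit coordinate vector \<open>b\<close> these are the usual partial derivative and its existence
  (real variables, complex values).\<close>

definition partial_deriv :: "real4 \<Rightarrow> (real4 \<Rightarrow> complex) \<Rightarrow> real4 \<Rightarrow> complex" where
  "partial_deriv b G z = vector_derivative (\<lambda>u. G (z + u *\<^sub>R b)) (at 0)"

definition partially_differentiable :: "real4 \<Rightarrow> (real4 \<Rightarrow> complex) \<Rightarrow> real4 \<Rightarrow> bool" where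
  "partially_differentiable b G z \<longleftrightarrow> (\<lambda>u. G (z + u *\<^sub>R b)) differentiable (at 0)"

text \<open>Iterated partial derivatives along a list of directions; as in
  \<open>\<partial>\<^sup>2 G / \<partial>x \<partial>y\<close>, the head of the list is the last differentiation carried out.\<close>

primrec iter_partial :: "real4 list \<Rightarrow> (real4 \<Rightarrow> complex) \<Rightarrow> real4 \<Rightarrow> complex" where
  "iter_partial [] G = G"
| "iter_partial (b # bs) G = partial_deriv b (iter_partial bs G)"

text \<open>\<open>vector_derivative\<close> is total, so existence of every intermediate derivative is stated
  separately. This is meaningful for open sets \<open>S\<close>.\<close>

primrec iter_partial_exists_on :: "real4 set \<Rightarrow> real4 list \<Rightarrow> (real4 \<Rightarrow> complex) \<Rightarrow> bool" where
  "iter_partial_exists_on S [] G \<longleftrightarrow> True"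
| "iter_partial_exists_on S (b # bs) G \<longleftrightarrow>
     iter_partial_exists_on S bs G \<and>
     (\<forall>z\<in>S. partially_differentiable b (iter_partial bs G) z)"

definition mixed_dirs :: "nat \<Rightarrow> nat \<Rightarrow> nat \<Rightarrow> nat \<Rightarrow> real4 list" where
  "mixed_dirs n1 n2 n3 n4 =
     replicate n1 (1, 0, 0, 0) @ replicate n2 (0, 1, 0, 0) @
     replicate n3 (0, 0, 1, 0) @ replicate n4 (0, 0, 0, 1)"

end

theory Submission
  imports Defs
begin

text \<open>For \<open>\<phi>(q,r,s,t) = (q/m, r/n, s/o', t/p)\<close> the transform is the Laplace integral
  \<open>z \<mapsto> \<integral> exp (- z \<bullet> \<phi>) f\<close>, and each derivative in a direction \<open>b\<close> produces a factor
  \<open>- b \<bullet> \<phi>\<close>. Differentiation under the integral is justified by dominated convergence: since the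
  integral exists on an open set, the integrable function \<open>exp (\<delta> \<bar>b \<bullet> \<phi>\<bar>) exp (- z \<bullet> \<phi>) \<bar>f\<bar>\<close>
  absorbs all difference quotients. The new integrand is again integrable on the same open set,
  so one can iterate.\<close>

section \<open>Elementary bounds for the real exponential\<close>

lemma abs_exp_minus_one_le: "\<bar>exp y - 1\<bar> \<le> \<bar>y\<bar> * exp \<bar>y\<bar>" for y :: real
proof (cases "y \<ge> 0")
  case True
  have "(1 - y) * exp y \<le> exp (- y) * exp y"
    using exp_ge_add_one_self[of "- y"] by (intro mult_right_mono) auto
  then show ?thesis
    using True by (simp add: algebra_simps flip: exp_add)
next
  case False
  have "1 - exp y \<le> - y"
    using exp_ge_add_one_self[of y] by linarith
  also have "\<dots> \<le> - y * exp (- y)"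
    using False by (intro mult_le_cancel_left1[THEN iffD2]) auto
  finally show ?thesis
    using False by simp
qed

lemma exp_mult_abs_le: "exp (d * \<bar>c\<bar>) \<le> exp (d * c) + exp (- d * c)" for c d :: real
  by (cases "c \<ge> 0") (auto simp: add_increasing add_increasing2)

text \<open>Half of the exponent \<open>d\<close> pays for the linear factor:
  \<open>\<bar>c\<bar>\<close> is at most \<open>2 / d * exp (d / 2 * \<bar>c\<bar>)\<close>. The
  two halves combine to \<open>exp (d * \<bar>c\<bar>)\<close>, which is split into the exponentials
  of both signs because only integrands of the form \<open>exp (u * c x)\<close> are known to be
  integrable.\<close>

lemma abs_mult_exp_le:
  fixes c d :: real
  assumes "d > 0"
  shows "\<bar>c\<bar> * exp (d / 2 * \<bar>c\<bar>) \<le> 2 / d * (exp (d * c) + exp (- d * c))"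
proof -
  have "d / 2 * \<bar>c\<bar> \<le> exp (d / 2 * \<bar>c\<bar>)"
    using exp_ge_add_one_self[of "d / 2 * \<bar>c\<bar>"] by linarith
  then have "\<bar>c\<bar> \<le> 2 / d * exp (d / 2 * \<bar>c\<bar>)"
    using assms by (simp add: field_simps)
  then have "\<bar>c\<bar> * exp (d / 2 * \<bar>c\<bar>) \<le> (2 / d * exp (d / 2 * \<bar>c\<bar>)) * exp (d / 2 * \<bar>c\<bar>)"
    by (intro mult_right_mono) auto
  also have "\<dots> = 2 / d * exp (d * \<bar>c\<bar>)"
    by (simp flip: exp_add)
  also have "\<dots> \<le> 2 / d * (exp (d * c) + exp (- d * c))"
    using assms exp_mult_abs_le by (intro mult_left_mono) auto
  finally show ?thesis .
qed

section \<open>Differentiation under the integral at a single point\<close>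

text \<open>Both claims rest on the same dominating function, hence the joint proof. The parameter
  must range over both signs of \<open>u\<close>, since \<open>c\<close> may take either sign. A
  derivative at 0 is enough: other base points are reached by absorbing a fixed exponential factor
  into \<open>k\<close>.\<close>

lemma
  fixes k :: "'a \<Rightarrow> 'b :: {banach, second_countable_topology}"
  assumes c [measurable]: "c \<in> borel_measurable M" and d: "d > 0"
    and int: "\<And>u. \<bar>u\<bar> \<le> d \<Longrightarrow> integrable M (\<lambda>x. exp (u * c x) *\<^sub>R k x)"
  shows integrable_scaleR_of_exponential: "integrable M (\<lambda>x. c x *\<^sub>R k x)"
    and has_vector_derivative_integral_exponential:
      "((\<lambda>u. \<integral>x. exp (u * c x) *\<^sub>R k x \<partial>M) has_vector_derivative (\<integral>x. c x *\<^sub>R k x \<partial>M)) (at 0)"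
proof -
  have k: "integrable M k"
    using int[of 0] d by simp
  then have [measurable]: "k \<in> borel_measurable M"
    by auto
  \<comment> \<open>The right-hand side of \<open>abs_mult_exp_le\<close> times
    \<open>norm (k x)\<close>; it is integrable by \<open>int\<close> at the endpoints
    \<open>d\<close> and \<open>- d\<close>.\<close>
  define w where "w = (\<lambda>x. 2 / d * (norm (exp (d * c x) *\<^sub>R k x) + norm (exp (- d * c x) *\<^sub>R k x)))"
  have w: "integrable M w"
    unfolding w_def using d
    by (intro integrable_mult_right Bochner_Integration.integrable_add integrable_norm int) auto
  have bound: "\<bar>c x\<bar> * exp (d / 2 * \<bar>c x\<bar>) * norm (k x) \<le> w x" for x
    using mult_right_mono[OF abs_mult_exp_le[OF d, of "c x"], of "norm (k x)"]
    by (simp add: w_def algebra_simps)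
  show 1: "integrable M (\<lambda>x. c x *\<^sub>R k x)"
  proof (rule Bochner_Integration.integrable_bound[OF w], measurable, intro AE_I2)
    fix x
    have "\<bar>c x\<bar> * 1 * norm (k x) \<le> \<bar>c x\<bar> * exp (d / 2 * \<bar>c x\<bar>) * norm (k x)"
      using d by (intro mult_right_mono mult_left_mono) auto
    then show "norm (c x *\<^sub>R k x) \<le> norm (w x)"
      using bound[of x] by simp
  qed
  define q where "q = (\<lambda>u x. ((exp (u * c x) - 1) / u) *\<^sub>R k x)"
  \<comment> \<open>Keeping \<open>u\<close> below \<open>d / 2\<close> in absolute value bounds the
    difference quotients by \<open>\<bar>c x\<bar> * exp (d / 2 * \<bar>c x\<bar>)\<close>, leaving
    the other half of \<open>d\<close> to absorb \<open>\<bar>c x\<bar>\<close>. The passage to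
    sequences makes dominated convergence applicable.\<close>
  have "((\<lambda>u. \<integral>x. q u x \<partial>M) \<longlongrightarrow> (\<integral>x. c x *\<^sub>R k x \<partial>M)) (at 0 within {- (d/2)<..<d/2})"
    unfolding tendsto_at_iff_sequentially comp_def
  proof (intro allI impI)
    fix X :: "nat \<Rightarrow> real"
    assume X: "\<forall>i. X i \<in> {- (d/2)<..<d/2} - {0}" and X0: "X \<longlonglongrightarrow> 0"
    show "(\<lambda>i. \<integral>x. q (X i) x \<partial>M) \<longlonglongrightarrow> (\<integral>x. c x *\<^sub>R k x \<partial>M)"
    proof (rule integral_dominated_convergence[OF _ _ w])
      show "(\<lambda>x. c x *\<^sub>R k x) \<in> borel_measurable M" "q (X i) \<in> borel_measurable M" for i
        unfolding q_def by measurable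
      have "(\<lambda>i. q (X i) x) \<longlonglongrightarrow> c x *\<^sub>R k x" for x
      proof -
        have "((\<lambda>u. exp (u * c x)) has_real_derivative c x) (at 0)"
          by (auto intro!: derivative_eq_intros)
        then have "((\<lambda>u. (exp (u * c x) - 1) / u) \<longlongrightarrow> c x) (at 0)"
          by (simp add: has_field_derivative_iff)
        then have "((\<lambda>u. (exp (u * c x) - 1) / u) \<longlongrightarrow> c x) (at 0 within UNIV)"
          by simp
        then have "(\<lambda>i. (exp (X i * c x) - 1) / X i) \<longlonglongrightarrow> c x"
          using X X0 unfolding tendsto_at_iff_sequentially comp_def by auto
        then show ?thesis
          unfolding q_def by (intro tendsto_intros)
      qed
      then show "AE x in M. (\<lambda>i. q (X i) x) \<longlonglongrightarrow> c x *\<^sub>R k x"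
        by simp
      have "norm (q (X i) x) \<le> w x" for i x
      proof -
        have Xi: "X i \<noteq> 0" "\<bar>X i\<bar> \<le> d / 2"
          using X[rule_format, of i] by auto
        have "\<bar>exp (X i * c x) - 1\<bar> \<le> \<bar>X i\<bar> * (\<bar>c x\<bar> * exp (\<bar>X i\<bar> * \<bar>c x\<bar>))"
          using abs_exp_minus_one_le[of "X i * c x"] by (simp add: abs_mult mult.assoc)
        then have "\<bar>(exp (X i * c x) - 1) / X i\<bar> \<le> \<bar>c x\<bar> * exp (\<bar>X i\<bar> * \<bar>c x\<bar>)"
          using Xi by (simp add: field_simps)
        also have "\<dots> \<le> \<bar>c x\<bar> * exp (d / 2 * \<bar>c x\<bar>)"
        proof -
          have "\<bar>X i\<bar> * \<bar>c x\<bar> \<le> d / 2 * \<bar>c x\<bar>"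
            using Xi by (intro mult_right_mono) auto
          then show ?thesis
            by (intro mult_left_mono) (simp_all only: exp_le_cancel_iff abs_ge_zero)
        qed
        finally have "norm (q (X i) x) \<le> \<bar>c x\<bar> * exp (d / 2 * \<bar>c x\<bar>) * norm (k x)"
          unfolding q_def norm_scaleR by (intro mult_right_mono) auto
        with bound[of x] show ?thesis
          by linarith
      qed
      then show "AE x in M. norm (q (X i) x) \<le> w x" for i
        by simp
    qed
  qed
  moreover have "at 0 within {- (d/2)<..<d/2} = at (0::real)"
    using d by (intro at_within_open) auto
  ultimately have lim: "((\<lambda>u. \<integral>x. q u x \<partial>M) \<longlongrightarrow> (\<integral>x. c x *\<^sub>R k x \<partial>M)) (at 0)"
    by simp
  define F where "F = (\<lambda>u. \<integral>x. exp (u * c x) *\<^sub>R k x \<partial>M)"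
  \<comment> \<open>This includes \<open>u = 0\<close>, where both sides vanish because division by
    zero yields 0.\<close>
  have quot: "(\<integral>x. q u x \<partial>M) = (F u - F 0) /\<^sub>R u" if "\<bar>u\<bar> \<le> d" for u
  proof -
    have "(\<integral>x. q u x \<partial>M) = (\<integral>x. inverse u *\<^sub>R (exp (u * c x) *\<^sub>R k x - k x) \<partial>M)"
      unfolding q_def by (intro Bochner_Integration.integral_cong)
        (auto simp: divide_inverse algebra_simps)
    then show ?thesis
      using int[OF that] k by (simp add: F_def)
  qed
  have "\<forall>\<^sub>F u in at 0. (\<integral>x. q u x \<partial>M) = (F u - F 0) /\<^sub>R u"
    unfolding eventually_at using d by (intro exI[of _ d]) (auto simp: dist_real_def intro!: quot)
  then have "((\<lambda>u. (F u - F 0) /\<^sub>R u) \<longlongrightarrow> (\<integral>x. c x *\<^sub>R k x \<partial>M)) (at 0)"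
    using lim by (simp add: tendsto_cong)
  then have "((\<lambda>u. norm ((F u - F 0) /\<^sub>R u - (\<integral>x. c x *\<^sub>R k x \<partial>M))) \<longlongrightarrow> 0) (at 0)"
    by (simp add: tendsto_norm_zero_iff LIM_zero)
  \<comment> \<open>Turns the error of the difference quotient into the remainder divided by
    \<open>norm u\<close>, the form in which \<open>has_derivative_at\<close> expresses the
    derivative.\<close>
  moreover have norm_quot: "norm ((F u - F 0) /\<^sub>R u - D) = norm (F (0 + u) - F 0 - u *\<^sub>R D) / norm u"
    if "u \<noteq> 0" for u D
  proof -
    have "(F u - F 0) /\<^sub>R u - D = (F (0 + u) - F 0 - u *\<^sub>R D) /\<^sub>R u"
      using that by (simp add: scaleR_diff_right)
    then show ?thesis
      by (simp add: divide_inverse_commute)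
  qed
  ultimately have "((\<lambda>u. norm (F (0 + u) - F 0 - u *\<^sub>R (\<integral>x. c x *\<^sub>R k x \<partial>M)) / norm u) \<longlongrightarrow> 0) (at 0)"
    by (elim Lim_transform_eventually) (simp only: norm_quot eventually_at_filter, simp)
  then show "((\<lambda>u. \<integral>x. exp (u * c x) *\<^sub>R k x \<partial>M) has_vector_derivative (\<integral>x. c x *\<^sub>R k x \<partial>M)) (at 0)"
    unfolding has_vector_derivative_def has_derivative_at F_def
    by (simp add: bounded_linear_scaleR_left)
qed

section \<open>Iterated partial derivatives of Laplace integrals\<close>

text \<open>Induction on the list of directions. Integrability of the differentiated integrand on
  all of \<open>S\<close> belongs to the claim because it is the hypothesis of the next
  differentiation. The factors produced do not depend on \<open>z\<close>, so they simply accumulate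
  in the product \<open>P\<close>.\<close>

lemma iter_partial_laplace_integral:
  fixes \<phi> :: "'a \<Rightarrow> real4" and g :: "'a \<Rightarrow> complex"
  assumes \<phi> [measurable]: "\<phi> \<in> borel_measurable M" and S: "open S"
    and int: "\<And>z. z \<in> S \<Longrightarrow> integrable M (\<lambda>x. exp (- (z \<bullet> \<phi> x)) *\<^sub>R g x)"
  defines "F \<equiv> \<lambda>z. \<integral>x. exp (- (z \<bullet> \<phi> x)) *\<^sub>R g x \<partial>M"
    and "P \<equiv> \<lambda>bs x. prod_list (map (\<lambda>b. - (b \<bullet> \<phi> x)) bs)"
  shows "iter_partial_exists_on S bs F \<and>
    (\<forall>z\<in>S. integrable M (\<lambda>x. P bs x *\<^sub>R exp (- (z \<bullet> \<phi> x)) *\<^sub>R g x) \<and>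
       iter_partial bs F z = (\<integral>x. P bs x *\<^sub>R exp (- (z \<bullet> \<phi> x)) *\<^sub>R g x \<partial>M))"
proof (induction bs)
  case Nil
  then show ?case
    using int by (simp add: P_def F_def)
next
  case (Cons b bs)
  define k where "k = (\<lambda>z x. P bs x *\<^sub>R exp (- (z \<bullet> \<phi> x)) *\<^sub>R g x)"
  \<comment> \<open>Moving \<open>z\<close> along \<open>b\<close> only multiplies the integrand by
    an exponential in \<open>u\<close>. This reduces the partial derivative at any \<open>z\<close>
    to the one-parameter result at \<open>u = 0\<close>, with \<open>c\<close> taken as
    \<open>- (b \<bullet> \<phi> x)\<close>.\<close>
  have k_shift: "k (z + u *\<^sub>R b) x = exp (u * - (b \<bullet> \<phi> x)) *\<^sub>R k z x" for z u x
    by (simp add: k_def inner_add_left exp_add exp_minus field_simps)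
  have IH: "integrable M (k z)" "iter_partial bs F z = (\<integral>x. k z x \<partial>M)" if "z \<in> S" for z
    using Cons.IH that by (auto simp: k_def)
  have step: "integrable M (\<lambda>x. - (b \<bullet> \<phi> x) *\<^sub>R k z x) \<and>
      ((\<lambda>u. iter_partial bs F (z + u *\<^sub>R b)) has_vector_derivative
        (\<integral>x. - (b \<bullet> \<phi> x) *\<^sub>R k z x \<partial>M)) (at 0)" if z: "z \<in> S" for z
  proof -
    define U where "U = (\<lambda>u. z + u *\<^sub>R b) -` S"
    have "open U"
      unfolding U_def by (intro open_vimage S continuous_intros)
    moreover have "0 \<in> U"
      using z by (simp add: U_def)
    ultimately obtain d where d: "d > 0" "cball 0 d \<subseteq> U"
      using open_contains_cball by blast
    have U: "iter_partial bs F (z + u *\<^sub>R b) = (\<integral>x. exp (u * - (b \<bullet> \<phi> x)) *\<^sub>R k z x \<partial>M)"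
      "integrable M (\<lambda>x. exp (u * - (b \<bullet> \<phi> x)) *\<^sub>R k z x)" if "u \<in> U" for u
      using IH[of "z + u *\<^sub>R b"] that unfolding k_shift U_def by auto
    have int': "integrable M (\<lambda>x. exp (u * - (b \<bullet> \<phi> x)) *\<^sub>R k z x)" if "\<bar>u\<bar> \<le> d" for u
      using U(2) d(2) that by auto
    have meas: "(\<lambda>x. - (b \<bullet> \<phi> x)) \<in> borel_measurable M"
      by measurable
    \<comment> \<open>The iterated partial is known to equal the integral only for \<open>u\<close>
      in \<open>U\<close>; as \<open>U\<close> is an open neighbourhood of 0, the derivative carries
      over.\<close>
    show ?thesis
      using integrable_scaleR_of_exponential[OF meas d(1) int']
        has_vector_derivative_transform_within_open[OF
          has_vector_derivative_integral_exponential[OF meas d(1) int'] \<open>open U\<close> \<open>0 \<in> U\<close>] U(1)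
      by simp
  qed
  have P_Cons: "P (b # bs) x *\<^sub>R exp (- (z \<bullet> \<phi> x)) *\<^sub>R g x = - (b \<bullet> \<phi> x) *\<^sub>R k z x" for z x
    by (simp add: P_def k_def)
  show ?case
    unfolding P_Cons iter_partial.simps iter_partial_exists_on.simps partial_deriv_def
      partially_differentiable_def
  proof (intro conjI ballI)
    show "iter_partial_exists_on S bs F"
      using Cons.IH by blast
    fix z
    assume "z \<in> S"
    note step = step[OF this]
    show "(\<lambda>u. iter_partial bs F (z + u *\<^sub>R b)) differentiable at 0"
      using step by (blast intro: differentiableI_vector)
    show "integrable M (\<lambda>x. - (b \<bullet> \<phi> x) *\<^sub>R k z x)"
      using step by blast
    show "vector_derivative (\<lambda>u. iter_partial bs F (z + u *\<^sub>R b)) (at 0) =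
        (\<integral>x. - (b \<bullet> \<phi> x) *\<^sub>R k z x \<partial>M)"
      using step by (blast intro: vector_derivative_at)
  qed
qed

section \<open>Specialisation to the quadruple Shehu transform\<close>

theorem mainTheorem4:
  fixes f :: "real \<Rightarrow> real \<Rightarrow> real \<Rightarrow> real \<Rightarrow> complex"
    and m n o' p h0 j0 k0 l0 :: real
  assumes "m > 0" and "n > 0" and "o' > 0" and "p > 0"
    and "h0 \<ge> 0" and "j0 \<ge> 0" and "k0 \<ge> 0" and "l0 \<ge> 0"
    and "\<And>h j k l. h > h0 \<Longrightarrow> j > j0 \<Longrightarrow> k > k0 \<Longrightarrow> l > l0 \<Longrightarrow>
           shehu4_exists f (h, j, k, l) (m, n, o', p)"
  shows "\<forall>n1 n2 n3 n4 :: nat.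
    iter_partial_exists_on ({h0<..} \<times> {j0<..} \<times> {k0<..} \<times> {l0<..}) (mixed_dirs n1 n2 n3 n4)
      (\<lambda>x. shehu4 f x (m, n, o', p)) \<and>
    (\<forall>h>h0. \<forall>j>j0. \<forall>k>k0. \<forall>l>l0.
      shehu4_exists (\<lambda>q r s t. complex_of_real (q ^ n1 * r ^ n2 * s ^ n3 * t ^ n4) * f q r s t)
        (h, j, k, l) (m, n, o', p) \<and>
      shehu4 (\<lambda>q r s t. complex_of_real (q ^ n1 * r ^ n2 * s ^ n3 * t ^ n4) * f q r s t)
        (h, j, k, l) (m, n, o', p) =
      (- 1) ^ (n1 + n2 + n3 + n4) * complex_of_real (m ^ n1 * n ^ n2 * o' ^ n3 * p ^ n4) *
      iter_partial (mixed_dirs n1 n2 n3 n4) (\<lambda>x. shehu4 f x (m, n, o', p)) (h, j, k, l))"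
proof -
  define \<phi> :: "real4 \<Rightarrow> real4" where "\<phi> = (\<lambda>(q, r, s, t). (q / m, r / n, s / o', t / p))"
  \<comment> \<open>The indicator moves into \<open>g\<close>, so that the set integral becomes an
    integral over the whole space.\<close>
  define g :: "real4 \<Rightarrow> complex"
    where "g = (\<lambda>(q, r, s, t). indicator quadrant4 (q, r, s, t) *\<^sub>R f q r s t)"
  define S where "S = {h0<..} \<times> {j0<..} \<times> {k0<..} \<times> {l0<..}"
  have \<phi>_borel: "\<phi> \<in> borel_measurable borel"
    unfolding \<phi>_def case_prod_beta using assms(1-4)
    by (intro borel_measurable_continuous_onI continuous_intros) auto
  then have \<phi>: "\<phi> \<in> borel_measurable lebesgue"
    by (intro measurable_completion) simp
  have S: "open S"
    unfolding S_def by (intro open_Times open_greaterThan)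
  have integrand: "indicator quadrant4 x *\<^sub>R shehu4_integrand f z (m, n, o', p) x =
      exp (- (z \<bullet> \<phi> x)) *\<^sub>R g x" for z x
    by (cases z; cases x) (simp add: \<phi>_def g_def scaleR_conv_of_real algebra_simps)
  have int: "integrable lebesgue (\<lambda>x. exp (- (z \<bullet> \<phi> x)) *\<^sub>R g x)" if "z \<in> S" for z
    using that assms(9) unfolding S_def shehu4_exists_def set_integrable_def integrand by auto
  have F: "(\<lambda>z. shehu4 f z (m, n, o', p)) =
      (\<lambda>z. \<integral>x. exp (- (z \<bullet> \<phi> x)) *\<^sub>R g x \<partial>lebesgue)"
    unfolding shehu4_def set_lebesgue_integral_def integrand ..
  note lap = iter_partial_laplace_integral[OF \<phi> S int, folded F]
  show ?thesis
    unfolding S_def[symmetric]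
  proof (intro allI conjI impI)
    fix n1 n2 n3 n4 :: nat
    let ?bs = "mixed_dirs n1 n2 n3 n4"
    let ?f = "\<lambda>q r s t. complex_of_real (q ^ n1 * r ^ n2 * s ^ n3 * t ^ n4) * f q r s t"
    let ?C = "(- 1) ^ (n1 + n2 + n3 + n4) * (m ^ n1 * n ^ n2 * o' ^ n3 * p ^ n4)"
    show "iter_partial_exists_on S ?bs (\<lambda>x. shehu4 f x (m, n, o', p))"
      using lap by blast
    fix h j k l
    assume "h > h0" "j > j0" "k > k0" "l > l0"
    then have z: "(h, j, k, l) \<in> S"
      by (simp add: S_def)
    let ?P = "\<lambda>x. prod_list (map (\<lambda>b. - (b \<bullet> \<phi> x)) ?bs)"
    \<comment> \<open>Each unit direction contributes minus one scaled coordinate, such as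
      \<open>- (q / m)\<close>; the signs and denominators in \<open>?C\<close> cancel these
      scalings, leaving the monomial.\<close>
    have factor: "?C * ?P (q, r, s, t) = q ^ n1 * r ^ n2 * s ^ n3 * t ^ n4" for q r s t
    proof -
      have cancel: "(- 1) ^ i * a ^ i * (- (x / a)) ^ i = x ^ i" if "a > 0" for a x :: real and i
        using that by (simp flip: power_mult_distrib)
      have "?P (q, r, s, t) =
          (- (q / m)) ^ n1 * (- (r / n)) ^ n2 * (- (s / o')) ^ n3 * (- (t / p)) ^ n4"
        by (simp add: mixed_dirs_def \<phi>_def prod_list_replicate)
      then have "?C * ?P (q, r, s, t) =
          ((- 1) ^ n1 * m ^ n1 * (- (q / m)) ^ n1) * ((- 1) ^ n2 * n ^ n2 * (- (r / n)) ^ n2) *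
          ((- 1) ^ n3 * o' ^ n3 * (- (s / o')) ^ n3) * ((- 1) ^ n4 * p ^ n4 * (- (t / p)) ^ n4)"
        by (simp only: power_add mult_ac)
      then show ?thesis
        by (simp only: cancel assms(1-4))
    qed
    \<comment> \<open>With the constant \<open>?C\<close> outside, both the existence and the value
      of the new transform follow from \<open>lap\<close> by pulling a scalar out of the
      integral.\<close>
    have eq: "indicator quadrant4 x *\<^sub>R shehu4_integrand ?f (h, j, k, l) (m, n, o', p) x =
        ?C *\<^sub>R (?P x *\<^sub>R exp (- ((h, j, k, l) \<bullet> \<phi> x)) *\<^sub>R g x)" for x
    proof (cases x)
      case (fields q r s t)
      have "?C *\<^sub>R (?P x *\<^sub>R exp (- ((h, j, k, l) \<bullet> \<phi> x)) *\<^sub>R g x) =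
          (?C * ?P x) *\<^sub>R exp (- ((h, j, k, l) \<bullet> \<phi> x)) *\<^sub>R g x"
        by (simp only: scaleR_scaleR mult.assoc)
      also have "\<dots> = (q ^ n1 * r ^ n2 * s ^ n3 * t ^ n4) *\<^sub>R
          indicator quadrant4 x *\<^sub>R shehu4_integrand f (h, j, k, l) (m, n, o', p) x"
        unfolding fields factor integrand ..
      finally show ?thesis
        by (simp add: fields scaleR_conv_of_real mult_ac)
    qed
    show "shehu4_exists ?f (h, j, k, l) (m, n, o', p)"
      unfolding shehu4_exists_def set_integrable_def eq
      using lap z by (intro integrable_scaleR_right) blast
    have "iter_partial ?bs (\<lambda>x. shehu4 f x (m, n, o', p)) (h, j, k, l) =
        (\<integral>x. ?P x *\<^sub>R exp (- ((h, j, k, l) \<bullet> \<phi> x)) *\<^sub>R g x \<partial>lebesgue)"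
      using lap z by blast
    then have "shehu4 ?f (h, j, k, l) (m, n, o', p) =
        ?C *\<^sub>R iter_partial ?bs (\<lambda>x. shehu4 f x (m, n, o', p)) (h, j, k, l)"
      by (simp only: shehu4_def[of ?f] set_lebesgue_integral_def eq integral_scaleR_right)
    then show "shehu4 ?f (h, j, k, l) (m, n, o', p) =
      (- 1) ^ (n1 + n2 + n3 + n4) * complex_of_real (m ^ n1 * n ^ n2 * o' ^ n3 * p ^ n4) *
      iter_partial ?bs (\<lambda>x. shehu4 f x (m, n, o', p)) (h, j, k, l)"
      by (simp add: scaleR_conv_of_real)
  qed
qed

end
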